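(* For every integer $c\ge 2$, the least integer $\lambda_3(c)\ge 0$ such that $M_3(c,\lambda_3(c))<\infty$ satisfies $$\left\lfloor\frac{c-1}{2}\right\rfloor\le \lambda_3(c)\le c-2.$$
   Context: A set $S$ of points in the plane in general position (no three on a line) is $c$-colored if it is partitioned into $c$ non-empty sets $S=S_1\sqcup\cdots\sqcup S_c$ (the color classes). A triangle is monochromatic if its three vertices are points of $S$ of the same color; its interior points are the points of $S$ lying in the interior of the triangle. For integers $c\ge 1$, $s\ge 0$, $M_3(c,s)$ denotes the least integer such that every set of at least $M_3(c,s)$ points in the plane, no three on a line, colored with $c$ colors, contains a monochromatic triangle with at most $s$ interior points; $M_3(c,s)=\infty$ if no such integer exists. *)

theory Defs
  imports
    "HOL-Analysis.Analysis"
    "HOL-Library.Disjoint_Sets"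
    "HOL-Library.Extended_Nat"
begin

definition general_position :: "(real ^ 2) set \<Rightarrow> bool" where
  "general_position S \<longleftrightarrow> (\<forall>T \<subseteq> S. card T = 3 \<longrightarrow> \<not> collinear T)"

text \<open>\<open>P\<close> is the set of colour classes; \<^const>\<open>partition_on\<close> already requires them to be non-empty.\<close>

definition colored :: "nat \<Rightarrow> (real ^ 2) set \<Rightarrow> (real ^ 2) set set \<Rightarrow> bool" where
  "colored c S P \<longleftrightarrow> partition_on S P \<and> card P = c"

text \<open>A triangle is represented by its set \<open>T\<close> of three vertices. Interior points are points of
  \<open>S\<close> of any colour.\<close>

definition monochromatic_triangle :: "(real ^ 2) set set \<Rightarrow> (real ^ 2) set \<Rightarrow> bool" where
  "monochromatic_triangle P T \<longleftrightarrow> card T = 3 \<and> (\<exists>C \<in> P. T \<subseteq> C)"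

definition interior_points :: "(real ^ 2) set \<Rightarrow> (real ^ 2) set \<Rightarrow> (real ^ 2) set" where
  "interior_points S T = S \<inter> interior (convex hull T)"

definition forces_triangle :: "nat \<Rightarrow> nat \<Rightarrow> nat \<Rightarrow> bool" where
  "forces_triangle c s n \<longleftrightarrow>
    (\<forall>S P. finite S \<and> general_position S \<and> colored c S P \<and> n \<le> card S \<longrightarrow>
      (\<exists>T. monochromatic_triangle P T \<and> card (interior_points S T) \<le> s))"

definition M3 :: "nat \<Rightarrow> nat \<Rightarrow> enat" where
  "M3 c s =
    (if \<exists>n. forces_triangle c s n then enat (LEAST n. forces_triangle c s n) else \<infinity>)"

text \<open>If no \<open>s\<close> with \<open>M3 c s < \<infinity>\<close> existed, this would be an unspecified number; statements about
  \<open>lambda3\<close> should therefore be accompanied by existence of such an \<open>s\<close>.\<close>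

definition lambda3 :: "nat \<Rightarrow> nat" where
  "lambda3 c = (LEAST s. M3 c s < \<infinity>)"

end

theory Submission imports Defs begin

text \<open>
  Upper bound, by induction on the number of colours. Let \<open>A\<close> be a largest colour class, with \<open>n\<close>
  points, \<open>h\<close> of them extreme. Triangulating with all of \<open>A\<close> gives \<open>2 * n - h - 2\<close> interior-disjoint
  triangles. If each contained \<open>c - 1\<close> points of the other classes, which have at most \<open>(c - 1) * n\<close>
  points altogether, then \<open>h \<ge> n - 2\<close>. A line through the at most two non-extreme points then cuts off
  a large convex polygon with vertices in \<open>A\<close> and no further point of \<open>A\<close>; it contains many points, all
  of the remaining \<open>c - 1\<close> colours.

  Lower bound: colour a Horton set of \<open>2 ^ N\<close> points, ordered by abscissa, periodically with the odd
  period \<open>2 * k + 1\<close>, where \<open>k = (c - 1) div 2\<close>. The points of even index and those of odd index are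
  again Horton sets, the second far above the first, and as the period is odd each of them is again coloured
  periodically. Thus one may assume that a monochromatic triangle has two vertices in one of the halves
  and the third one in the other; it then contains the points of the first half that lie between the first
  two vertices on the proper side of the line through them, and there are at least \<open>k\<close> of these.
\<close>

section \<open>Horton sets\<close>

text \<open>In the Horton set with points numbered by abscissa, and for \<open>i < j < l\<close>, \<open>hor i j l\<close> says that
  point \<open>j\<close> lies above the segment from point \<open>i\<close> to point \<open>l\<close>.\<close>

fun hor :: "nat \<Rightarrow> nat \<Rightarrow> nat \<Rightarrow> bool" where
  "hor i j l = (if l < 2 \<or> \<not> (odd i = odd j \<and> odd j = odd l) then odd j
     else hor (i div 2) (j div 2) (l div 2))"

declare hor.simps [simp del]

lemma hor_mixed: "\<not> (odd i = odd j \<and> odd j = odd l) \<Longrightarrow> hor i j l = odd j"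
  by (subst hor.simps) simp

lemma hor_same:
  assumes "i < j" "j < l" "odd i = odd j" "odd j = odd l"
  shows "hor i j l = hor (i div 2) (j div 2) (l div 2)"
  using assms by (subst hor.simps) simp

text \<open>Keeps the order of indices of equal parity when a recursion step of \<open>hor\<close>
  passes to the halves.\<close>

lemma div2_less:
  fixes i j :: nat
  assumes "i < j" "odd i = odd j"
  shows "i div 2 < j div 2"
  using assms by (cases "odd i") (auto elim!: evenE oddE)

section \<open>Counting the indices on either side of a segment\<close>

lemma card_parity_between:
  fixes p q :: nat
  assumes "p < q"
  shows "(q - p - 1) div 2 \<le> card {w \<in> {p<..<q}. odd w = v}"
proof -
  define g where "g j = p + 1 + 2 * j + (if odd (p + 1) = v then 0 else 1)" for j :: nat
  have "g ` {..<(q - p - 1) div 2} \<subseteq> {w \<in> {p<..<q}. odd w = v}"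
    using assms by (auto simp: g_def)
  moreover have "inj_on g {..<(q - p - 1) div 2}"
    by (auto simp: inj_on_def g_def)
  ultimately show ?thesis
    using card_inj_on_le[of g "{..<(q - p - 1) div 2}"] by simp
qed

lemma card_le_inj:
  assumes "inj_on f A" "f ` A \<subseteq> B" "finite B" "k \<le> card A"
  shows "k \<le> card B"
  using card_inj_on_le[OF assms(1-3)] assms(4) by linarith

text \<open>For equal parities \<open>q - p\<close> is twice the difference of the halves, and an
  odd \<open>c\<close> is coprime to 2. This is how a periodic colouring with odd period stays
  periodic on each half of the Horton set.\<close>

lemma dvd_half_diff:
  fixes p q c :: nat
  assumes "odd c" "c dvd q - p" "odd p = odd q" "p < q"
  shows "c dvd q div 2 - p div 2"
proof -
  have "q - p = 2 * (q div 2 - p div 2)"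
    using assms(3,4) by (cases "odd p") (auto simp: diff_mult_distrib2 elim!: evenE oddE)
  then show ?thesis
    using assms(1,2) by (metis coprime_dvd_mult_right_iff coprime_right_2_iff_odd)
qed

text \<open>If an endpoint has the parity other than \<open>v\<close>, every index of parity
  \<open>v\<close> between \<open>p\<close> and \<open>q\<close> is on side \<open>v\<close>, and a
  multiple of \<open>2 * k + 1\<close> leaves room for \<open>k\<close> of them. If both endpoints
  have parity \<open>v\<close>, the indices of their own class suffice, and these form the same
  situation at half the size.\<close>

lemma card_hor_side:
  assumes "p < q" "2 * k + 1 dvd q - p"
  shows "k \<le> card {w \<in> {p<..<q}. hor p w q = v}"
  using assms
proof (induction q arbitrary: p rule: less_induct)
  case (less q)
  show ?case
  proof (cases "odd p = v \<and> odd q = v")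
    case True
    have pq: "p div 2 < q div 2"
      using True less.prems by (intro div2_less) auto
    have IH: "k \<le> card {w \<in> {p div 2<..<q div 2}. hor (p div 2) w (q div 2) = v}"
      using True less.prems pq by (intro less.IH dvd_half_diff) auto
    \<comment> \<open>The inverse of halving on the class of parity \<open>v\<close>; it transports
      the indices found by the induction hypothesis.\<close>
    define f where "f w = 2 * w + of_bool v" for w :: nat
    show ?thesis
    proof (rule card_le_inj[where f = f, OF _ _ _ IH])
      show "f ` {w \<in> {p div 2<..<q div 2}. hor (p div 2) w (q div 2) = v}
          \<subseteq> {w \<in> {p<..<q}. hor p w q = v}"
      proof (rule image_subsetI)
        fix w assume w: "w \<in> {w \<in> {p div 2<..<q div 2}. hor (p div 2) w (q div 2) = v}"
        have 1: "odd (f w) = v" "f w div 2 = w" by (auto simp: f_def)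
        have 2: "p < f w" "f w < q"
          using w True by (cases v; auto simp: f_def elim!: evenE oddE)+
        have "hor p (f w) q = hor (p div 2) w (q div 2)"
          using 1 2 True by (subst hor_same) auto
        then show "f w \<in> {w \<in> {p<..<q}. hor p w q = v}"
          using 2 w by auto
      qed
    qed (auto simp: f_def inj_on_def)
  next
    case False
    have "k \<le> (q - p - 1) div 2"
      using dvd_imp_le[OF less.prems(2)] less.prems(1) by linarith
    also have "\<dots> \<le> card {w \<in> {p<..<q}. odd w = v}"
      using less.prems by (intro card_parity_between)
    also have "\<dots> \<le> card {w \<in> {p<..<q}. hor p w q = v}"
      using False by (intro card_mono) (auto simp: hor_mixed)
    finally show ?thesis .
  qed
qed

text \<open>The combinatorial form of: point \<open>w\<close> is interior to the triangle \<open>a < b < l\<close>.\<close>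

definition hor_inside :: "nat \<Rightarrow> nat \<Rightarrow> nat \<Rightarrow> nat \<Rightarrow> bool" where
  "hor_inside a b l w \<longleftrightarrow> hor a w l = hor a b l \<and>
     (a < w \<and> w < b \<and> hor a w b \<noteq> hor a b l \<or> b < w \<and> w < l \<and> hor b w l \<noteq> hor a b l)"

text \<open>The class of \<open>r\<close> lies so far above or below that every comparison involving
  \<open>r\<close> is mixed and decided by the parity of its middle index. The condition
  \<open>hor p w q \<noteq> e\<close> puts \<open>w\<close> on the side of the segment from
  \<open>p\<close> to \<open>q\<close> that faces \<open>r\<close>.\<close>

lemma hor_inside_apex:
  assumes ab: "a < b" "b < l"
    and T: "{a, b, l} = {p, q, r}"
    and pq: "p < q" "odd p = e" "odd q = e" "odd r \<noteq> e"
    and w: "p < w" "w < q" "odd w = e" "hor p w q \<noteq> e"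
  shows "hor_inside a b l w"
proof -
  have mixed: "hor r w q = e" "hor p w r = e" "hor p r q = (\<not> e)" "hor r p q = e" "hor p q r = e"
    using hor_mixed[of r w q] hor_mixed[of p w r] hor_mixed[of p r q] hor_mixed[of r p q]
      hor_mixed[of p q r] pq w by blast+
  have above: "hor p w q = (\<not> e)" and "r < w \<or> w < r"
    using pq w by (blast, metis nat_neq_iff)
  \<comment> \<open>The apex \<open>r\<close> may come between, before or after \<open>p\<close> and
    \<open>q\<close> in the order of abscissae.\<close>
  consider "a = p" "b = r" "l = q" | "a = r" "b = p" "l = q" | "a = p" "b = q" "l = r"
  proof -
    have "p = a \<or> p = b \<or> p = l" "q = a \<or> q = b \<or> q = l" "r = a \<or> r = b \<or> r = l" "r \<noteq> p" "r \<noteq> q"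
      using T pq by auto
    then have "a = p \<and> b = r \<and> l = q \<or> a = r \<and> b = p \<and> l = q \<or> a = p \<and> b = q \<and> l = r"
      using ab pq(1) by (elim disjE) simp_all
    then show ?thesis using that by blast
  qed
  then show ?thesis
  proof cases
    case 1
    then show ?thesis
      using mixed above w(1,2) \<open>r < w \<or> w < r\<close> by (simp add: hor_inside_def) blast
  next
    case 2
    then show ?thesis using mixed above ab w(1,2) by (simp add: hor_inside_def)
  next
    case 3
    then show ?thesis using mixed above ab w(1,2) by (simp add: hor_inside_def)
  qed
qed

text \<open>Halving is repeated as long as the three vertices share a parity. Once they do not, two
  of them do, and the points of their class between them on the side of the third are inside by
  \<open>hor_inside_apex\<close>.\<close>

lemma card_hor_inside:
  assumes "a < b" "b < l" "2 * k + 1 dvd b - a" "2 * k + 1 dvd l - b"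
  shows "k \<le> card {w. hor_inside a b l w}"
  using assms
proof (induction l arbitrary: a b rule: less_induct)
  case (less l)
  have fin: "finite {w. hor_inside a' b' l' w}" for a' b' l'
    by (rule finite_subset[of _ "{..<b'} \<union> {..<l'}"]) (auto simp: hor_inside_def)
  show ?case
  proof (cases "odd a = odd b \<and> odd b = odd l")
    case True
    have lt: "a div 2 < b div 2" "b div 2 < l div 2"
      using True less.prems by (auto intro!: div2_less)
    have IH: "k \<le> card {w. hor_inside (a div 2) (b div 2) (l div 2) w}"
      using True less.prems lt by (intro less.IH dvd_half_diff) auto
    define f where "f w = 2 * w + of_bool (odd a)" for w :: nat
    have 1: "odd (f w) = odd a" "f w div 2 = w" for w by (auto simp: f_def)
    have mono: "x div 2 < w \<Longrightarrow> x < f w" "w < x div 2 \<Longrightarrow> f w < x" if "odd x = odd a" for x w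
      using that by (cases "odd a"; auto simp: f_def elim!: evenE oddE)+
    show ?thesis
    proof (rule card_le_inj[where f = f, OF _ _ fin IH])
      show "f ` {w. hor_inside (a div 2) (b div 2) (l div 2) w} \<subseteq> {w. hor_inside a b l w}"
      proof safe
        fix w assume w: "hor_inside (a div 2) (b div 2) (l div 2) w"
        have "a < f w" "f w < l"
          using w mono[of a w] mono[of l w] lt True by (auto simp: hor_inside_def)
        then have "hor a (f w) l = hor (a div 2) w (l div 2)"
          using 1 True by (subst hor_same) auto
        moreover have "hor a b l = hor (a div 2) (b div 2) (l div 2)"
          using True less.prems by (subst hor_same) auto
        moreover have "hor a (f w) b = hor (a div 2) w (b div 2)" if "f w < b"
          using 1 True \<open>a < f w\<close> that by (subst hor_same) auto
        moreover have "hor b (f w) l = hor (b div 2) w (l div 2)" if "b < f w"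
          using 1 True \<open>f w < l\<close> that by (subst hor_same) auto
        ultimately show "hor_inside a b l (f w)"
          using w mono[of a w] mono[of b w] mono[of l w] True unfolding hor_inside_def by auto
      qed
    qed (auto simp: f_def inj_on_def)
  next
    case False
    have al: "2 * k + 1 dvd l - a"
      using dvd_add[OF less.prems(3,4)] less.prems(1,2) by simp
    obtain p q r where pqr: "{a, b, l} = {p, q, r}" "p < q" "2 * k + 1 dvd q - p"
        "odd p = odd q" "odd r \<noteq> odd q"
    proof -
      consider "odd a = odd b" "odd l \<noteq> odd b" | "odd a = odd l" "odd b \<noteq> odd l"
        | "odd b = odd l" "odd a \<noteq> odd l"
        using False by blast
      then show ?thesis
      proof cases
        case 1 then show ?thesis using less.prems by (intro that[of a b l]) auto
      next
        case 2 then show ?thesis using less.prems al by (intro that[of a l b]) auto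
      next
        case 3 then show ?thesis using less.prems by (intro that[of b l a]) auto
      qed
    qed
    define e where "e = odd q"
    have lt: "p div 2 < q div 2"
      using pqr by (intro div2_less) auto
    \<comment> \<open>The bound is applied to the halves so that only points of the class of
      \<open>p\<close> and \<open>q\<close> are counted. Side \<open>\<not> e\<close> faces
      \<open>r\<close>, because the odd class lies above the even one.\<close>
    have half: "k \<le> card {w \<in> {p div 2<..<q div 2}. hor (p div 2) w (q div 2) = (\<not> e)}"
      using pqr lt by (intro card_hor_side dvd_half_diff) auto
    define f where "f w = 2 * w + of_bool e" for w :: nat
    show ?thesis
    proof (rule card_le_inj[where f = f, OF _ _ fin half])
      show "f ` {w \<in> {p div 2<..<q div 2}. hor (p div 2) w (q div 2) = (\<not> e)}
          \<subseteq> {w. hor_inside a b l w}"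
      proof (rule image_subsetI)
        fix w assume w: "w \<in> {w \<in> {p div 2<..<q div 2}. hor (p div 2) w (q div 2) = (\<not> e)}"
        have 1: "odd (f w) = e" "f w div 2 = w" by (auto simp: f_def)
        have 2: "p < f w" "f w < q"
          using w pqr(4) by (cases e; auto simp: f_def e_def elim!: evenE oddE)+
        have "hor p (f w) q = hor (p div 2) w (q div 2)"
          using 1 2 pqr(4) e_def by (subst hor_same) auto
        then show "f w \<in> {w. hor_inside a b l w}"
          unfolding mem_Collect_eq using 1 2 w pqr(4,5)
          by (intro hor_inside_apex[OF less.prems(1,2) pqr(1,2), of e "f w"]) (simp_all add: e_def)
      qed
    qed (auto simp: f_def inj_on_def)
  qed
qed

section \<open>Realizing the index combinatorics by points in the plane\<close>

text \<open>For \<open>i < j < l\<close> this is positive iff \<open>(j, f j)\<close> is above the segment from \<open>(i, f i)\<close> to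
  \<open>(l, f l)\<close>.\<close>

definition rise :: "(nat \<Rightarrow> real) \<Rightarrow> nat \<Rightarrow> nat \<Rightarrow> nat \<Rightarrow> real" where
  "rise f i j l = (f j - f i) * (real l - real i) - (f l - f i) * (real j - real i)"

text \<open>Supplies the height by which one half of a Horton set is lifted above the other.\<close>

lemma bounded_on_triples:
  fixes F :: "nat \<Rightarrow> nat \<Rightarrow> nat \<Rightarrow> real"
  shows "\<exists>B. \<forall>i<n. \<forall>j<n. \<forall>l<n. \<bar>F i j l\<bar> < B"
proof -
  define G where "G = (\<lambda>(i, j, l). \<bar>F i j l\<bar>)"
  have "G (i, j, l) \<le> sum G ({..<n} \<times> {..<n} \<times> {..<n})" if "i < n" "j < n" "l < n" for i j l
    using that by (intro member_le_sum) (auto simp: G_def)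
  then show ?thesis
    by (intro exI[of _ "sum G ({..<n} \<times> {..<n} \<times> {..<n}) + 1"]) (fastforce simp: G_def)
qed

text \<open>Two copies of the realization for \<open>N\<close>, stretched horizontally by the factor
  2, are interleaved, and the odd copy is lifted by a large \<open>B\<close>. Since
  \<open>rise\<close> is linear in the heights, the lift dominates on triples of mixed parity and
  cancels on the others.\<close>

lemma hor_realizable:
  "\<exists>f. \<forall>i j l. i < j \<and> j < l \<and> l < 2 ^ N \<longrightarrow>
     (if hor i j l then rise f i j l > 0 else rise f i j l < 0)"
proof (induction N)
  case 0
  then show ?case by auto
next
  case (Suc N)
  then obtain f where f: "\<And>i j l. i < j \<Longrightarrow> j < l \<Longrightarrow> l < 2 ^ N \<Longrightarrow>
      (if hor i j l then rise f i j l > 0 else rise f i j l < 0)"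
    by blast
  define g where "g i = f (i div 2)" for i :: nat
  obtain B where B: "\<forall>i<2 ^ Suc N. \<forall>j<2 ^ Suc N. \<forall>l<2 ^ Suc N. \<bar>rise g i j l\<bar> < B"
    using bounded_on_triples by blast
  define h where "h i = of_bool (odd i) * B + g i" for i :: nat
  \<comment> \<open>The \<open>rise\<close> of the parity function itself, that is, the coefficient
    of \<open>B\<close> in \<open>rise h\<close>. It vanishes on triples of one parity; otherwise it
    has absolute value at least 1 and a sign given by the parity of \<open>j\<close>.\<close>
  define c where "c i j l = (of_bool (odd j) - of_bool (odd i)) * (real l - real i)
      - (of_bool (odd l) - of_bool (odd i)) * (real j - real i)" for i j l :: nat
  have rise_h: "rise h i j l = B * c i j l + rise g i j l" for i j l :: nat
    by (simp add: rise_def h_def c_def algebra_simps)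
  show ?case
  proof (intro exI[of _ h] allI impI; elim conjE)
    fix i j l :: nat assume ijl: "i < j" "j < l" "l < 2 ^ Suc N"
    have bd: "\<bar>rise g i j l\<bar> < B"
      using B ijl by auto
    show "if hor i j l then rise h i j l > 0 else rise h i j l < 0"
    proof (cases "odd i = odd j \<and> odd j = odd l")
      case True
      have lt: "i div 2 < j div 2" "j div 2 < l div 2" "l div 2 < 2 ^ N"
        using ijl True by (auto intro!: div2_less)
      have half: "real m = 2 * real (m div 2) + of_bool (odd m)" for m :: nat
        by (cases "even m") (auto elim!: evenE oddE)
      have eq: "real i = 2 * real (i div 2) + of_bool (odd i)"
        "real j = 2 * real (j div 2) + of_bool (odd i)"
        "real l = 2 * real (l div 2) + of_bool (odd i)"
        using half[of i] half[of j] half[of l] True by simp_all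
      have "rise h i j l = 2 * rise f (i div 2) (j div 2) (l div 2)"
        using True unfolding rise_def h_def g_def eq by (simp add: algebra_simps)
      then show ?thesis
        using f[OF lt] hor_same[OF ijl(1,2)] True by auto
    next
      case False
      have "if odd j then c i j l \<ge> 1 else c i j l \<le> -1"
        using False ijl by (auto simp: c_def)
      moreover have "B * c i j l \<ge> B" if "c i j l \<ge> 1"
        using bd that mult_left_mono[of 1 "c i j l" B] by auto
      moreover have "B * c i j l \<le> - B" if "c i j l \<le> -1"
        using bd that mult_left_mono[of "c i j l" "-1" B] by auto
      ultimately show ?thesis
        using bd hor_mixed[OF False] rise_h[of i j l] by (auto split: if_splits)
    qed
  qed
qed

definition graph_point :: "(nat \<Rightarrow> real) \<Rightarrow> nat \<Rightarrow> real ^ 2" where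
  "graph_point f i = vector [real i, f i]"

lemma graph_point_nth [simp]: "graph_point f i $ 1 = real i" "graph_point f i $ 2 = f i"
  by (simp_all add: graph_point_def)

lemma graph_point_eq_iff [simp]: "graph_point f i = graph_point f j \<longleftrightarrow> i = j"
  by (metis graph_point_nth(1) of_nat_eq_iff)

lemma not_collinear_graph_points:
  assumes "i < j" "j < l" "rise f i j l \<noteq> 0"
  shows "\<not> collinear {graph_point f i, graph_point f j, graph_point f l}"
proof
  assume "collinear {graph_point f i, graph_point f j, graph_point f l}"
  then obtain u where "graph_point f j = u *\<^sub>R graph_point f i + (1 - u) *\<^sub>R graph_point f l"
    using assms by (auto simp: collinear_3_expand)
  then have "real j = u * real i + (1 - u) * real l" "f j = u * f i + (1 - u) * f l"
    by (auto simp: vec_eq_iff forall_2)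
  then have "rise f i j l = (u * f i + (1 - u) * f l - f i) * (real l - real i)
      - (f l - f i) * (u * real i + (1 - u) * real l - real i)"
    by (simp only: rise_def)
  then have "rise f i j l = 0"
    by (simp add: algebra_simps)
  then show False using assms by simp
qed

text \<open>A point is interior iff its barycentric coordinates are positive. The hypotheses give
  two of the signs directly, and the position of \<open>w\<close> relative to \<open>b\<close>
  forces the third.\<close>

lemma interior_triangleI:
  assumes lt: "a < b" "b < l"
    and w: "a < w \<and> w < b \<and> rise f a w b / rise f a b l < 0 \<or>
      b < w \<and> w < l \<and> rise f b w l / rise f a b l < 0"
    and "rise f a w l / rise f a b l > 0"
  shows "graph_point f w \<in> interior (convex hull {graph_point f a, graph_point f b, graph_point f l})"
proof -
  define D where "D = rise f a b l"
  have D: "D \<noteq> 0" using assms(4) unfolding D_def by auto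
  \<comment> \<open>Up to sign, \<open>rise\<close> is twice the area of a triangle, so by Cramer's
    rule \<open>x\<close>, \<open>y\<close>, \<open>z\<close> are the barycentric coordinates of
    point \<open>w\<close>.\<close>
  define y where "y = rise f a w l / D"
  define x where "x = - rise f b w l / D"
  define z where "z = - rise f a w b / D"
  have sum: "x + y + z = 1"
    using D unfolding x_def y_def z_def D_def rise_def
    by (simp add: divide_simps) (simp add: algebra_simps)
  have e1: "x * real a + y * real b + z * real l = real w"
    using D unfolding x_def y_def z_def D_def rise_def
    by (simp add: divide_simps) (simp add: algebra_simps)
  have e2: "x * f a + y * f b + z * f l = f w"
    using D unfolding x_def y_def z_def D_def rise_def
    by (simp add: divide_simps) (simp add: algebra_simps)
  have y: "y > 0" using assms(4) by (simp add: y_def D_def)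
  from w have "x > 0 \<and> z > 0"
  proof
    assume *: "a < w \<and> w < b \<and> rise f a w b / rise f a b l < 0"
    then have z: "z > 0" by (simp add: z_def D_def)
    have x: "x = 1 - y - z" using sum by simp
    have "real b - real w = x * (real b - real a) - z * (real l - real b)"
      unfolding e1[symmetric] x by (simp add: algebra_simps)
    moreover have "z * (real l - real b) > 0" "real b - real w > 0"
      using z lt * by auto
    ultimately have "x * (real b - real a) > 0" by linarith
    then show ?thesis using z lt by (simp add: zero_less_mult_iff)
  next
    assume *: "b < w \<and> w < l \<and> rise f b w l / rise f a b l < 0"
    then have x: "x > 0" by (simp add: x_def D_def)
    have y: "y = 1 - x - z" using sum by simp
    have "real w - real b = z * (real l - real b) - x * (real b - real a)"
      unfolding e1[symmetric] y by (simp add: algebra_simps)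
    moreover have "x * (real b - real a) > 0" "real w - real b > 0"
      using x lt * by auto
    ultimately have "z * (real l - real b) > 0" by linarith
    then show ?thesis using x lt by (simp add: zero_less_mult_iff)
  qed
  moreover have "x *\<^sub>R graph_point f a + y *\<^sub>R graph_point f b + z *\<^sub>R graph_point f l = graph_point f w"
    using e1 e2 by (simp add: vec_eq_iff forall_2)
  moreover have "\<not> collinear {graph_point f a, graph_point f b, graph_point f l}"
    using D lt by (intro not_collinear_graph_points) (auto simp: D_def)
  ultimately show ?thesis
    using y sum by (subst interior_convex_hull_3_minimal) auto
qed

section \<open>The lower bound from periodically coloured Horton sets\<close>

lemma three_nats_sorted:
  fixes I :: "nat set"
  assumes "card I = 3"
  obtains a b l where "I = {a, b, l}" "a < b" "b < l"
proof -
  from assms obtain x y z where "I = {x, y, z}" "x \<noteq> y" "y \<noteq> z" "x \<noteq> z"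
    by (auto simp: card_3_iff)
  then show ?thesis
    using that[of x y z] that[of x z y] that[of y x z] that[of y z x] that[of z x y] that[of z y x]
    by (auto simp: insert_commute neq_iff)
qed

text \<open>In arbitrarily large Horton sets coloured with period \<open>2 * k + 1\<close>, each
  monochromatic triangle has at least \<open>k\<close> interior points by
  \<open>card_hor_inside\<close>.\<close>

lemma not_forces_triangle:
  assumes "c \<ge> 2" "s < (c - 1) div 2"
  shows "\<not> forces_triangle c s n"
proof
  assume forces: "forces_triangle c s n"
  define k where "k = (c - 1) div 2"
  \<comment> \<open>Then \<open>2 ^ N\<close> exceeds both \<open>n\<close>, for the required size,
    and \<open>c\<close>, so that the first \<open>c\<close> points show every colour.\<close>
  define N where "N = n + c"
  have N: "n + c < 2 ^ N" unfolding N_def by (rule less_exp)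
  obtain f where f: "\<And>i j l. i < j \<Longrightarrow> j < l \<Longrightarrow> l < 2 ^ N \<Longrightarrow>
      (if hor i j l then rise f i j l > 0 else rise f i j l < 0)"
    using hor_realizable[of N] by blast
  define S where "S = graph_point f ` {..<2 ^ N}"
  \<comment> \<open>For odd \<open>c\<close> the exception agrees with the residue. For even
    \<open>c\<close> there are only \<open>c - 1\<close> residues, and the point
    \<open>c - 1\<close> alone receives the missing colour, which creates no new monochromatic
    triangle.\<close>
  define col where "col i = (if i = c - 1 then c - 1 else i mod (2 * k + 1))" for i
  define cls where "cls r = graph_point f ` {i \<in> {..<2 ^ N}. col i = r}" for r
  define P where "P = cls ` {..<c}"
  have kc: "2 * k + 1 = c \<or> 2 * k + 2 = c"
    using assms(1) unfolding k_def by linarith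
  have col_self: "col i = i" if "i < c" for i
    using that kc by (auto simp: col_def)
  have m_lt: "i mod (2 * k + 1) < 2 * k + 1" for i
    by (rule mod_less_divisor) simp
  have col_less: "col i < c" for i
    using m_lt[of i] assms(1) kc by (auto simp only: col_def split: if_splits)
  have col_mod: "i mod (2 * k + 1) = j mod (2 * k + 1)" if "col i = col j" for i j
  proof -
    \<comment> \<open>A point of colour \<open>c - 1\<close> is either the exceptional point or has
      residue \<open>c - 1\<close>, so the exception does not spoil the congruence.\<close>
    have "j mod (2 * k + 1) = (c - 1) mod (2 * k + 1)" if "col j = c - 1" for j
    proof (cases "j = c - 1")
      case False
      then have "j mod (2 * k + 1) = c - 1" using that by (simp add: col_def)
      then show ?thesis by (metis mod_mod_trivial)
    qed simp
    note * = this
    show ?thesis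
    proof (cases "i = c - 1 \<or> j = c - 1")
      case True
      moreover have "col (c - 1) = c - 1" by (simp add: col_def)
      ultimately have "col i = c - 1" "col j = c - 1" using that by metis+
      then show ?thesis by (simp only: *)
    next
      case False
      then show ?thesis using that by (simp only: col_def de_Morgan_disj if_False)
    qed
  qed
  have col_dvd: "2 * k + 1 dvd j - i" if "col i = col j" "i < j" for i j
    using col_mod[OF that(1)] that(2) by (metis less_imp_le mod_eq_dvd_iff_nat)
  have triple: "\<exists>a b l. T = {graph_point f a, graph_point f b, graph_point f l} \<and> a < b \<and> b < l \<and> l < 2 ^ N"
    if T: "T \<subseteq> S" "card T = 3" for T
  proof -
    obtain I where I: "I \<subseteq> {..<2 ^ N}" "T = graph_point f ` I"
      using T(1) unfolding S_def by (metis subset_imageE)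
    then have "card I = 3"
      using T(2) by (simp add: card_image inj_on_def)
    then obtain a b l where "I = {a, b, l}" "a < b" "b < l"
      by (rule three_nats_sorted)
    then show ?thesis using I by (intro exI[of _ a] exI[of _ b] exI[of _ l]) auto
  qed
  have "finite S" by (simp add: S_def)
  moreover have "general_position S"
    unfolding general_position_def
  proof (intro allI impI)
    fix T assume "T \<subseteq> S" "card T = 3"
    then obtain a b l where abl: "T = {graph_point f a, graph_point f b, graph_point f l}" "a < b" "b < l" "l < 2 ^ N"
      using triple by blast
    then show "\<not> collinear T"
      using f[of a b l] not_collinear_graph_points[of a b l f] by (auto split: if_splits)
  qed
  moreover have "colored c S P"
  proof -
    have in_cls: "graph_point f r \<in> cls r" if "r < c" for r
      using that N col_self by (auto simp: cls_def)
    have "partition_on S P"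
    proof (rule partition_onI)
      show "\<Union> P = S"
        using col_less by (auto simp: P_def S_def cls_def)
      show "disjnt p q" if "p \<in> P" "q \<in> P" "p \<noteq> q" for p q
        using that by (auto simp: P_def cls_def disjnt_def)
      show "{} \<notin> P" using in_cls by (force simp: P_def)
    qed
    moreover have "card P = c"
    proof -
      have "inj_on cls {..<c}"
      proof (rule inj_onI)
        fix r r' assume r: "r \<in> {..<c}" "r' \<in> {..<c}" "cls r = cls r'"
        then have "graph_point f r \<in> cls r'" using in_cls[of r] by blast
        then show "r = r'" using r col_self by (auto simp: cls_def)
      qed
      then show ?thesis by (simp add: P_def card_image)
    qed
    ultimately show ?thesis by (simp add: colored_def)
  qed
  moreover have "n \<le> card S"
    using N by (simp add: S_def card_image inj_on_def)
  ultimately obtain T where T: "monochromatic_triangle P T" "card (interior_points S T) \<le> s"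
    using forces unfolding forces_triangle_def by blast
  then obtain r where r: "card T = 3" "T \<subseteq> cls r"
    by (auto simp: monochromatic_triangle_def P_def)
  then have "T \<subseteq> S" by (auto simp: cls_def S_def)
  then obtain a b l where abl: "T = {graph_point f a, graph_point f b, graph_point f l}" "a < b" "b < l" "l < 2 ^ N"
    using triple r(1) by blast
  have col: "col a = r" "col b = r" "col l = r"
    using r(2) unfolding abl(1) cls_def by auto
  have "k \<le> card {w. hor_inside a b l w}"
    using abl col by (intro card_hor_inside col_dvd) auto
  then have "k \<le> card (interior_points S T)"
  proof (rule card_le_inj[where f = "graph_point f", rotated 3])
    show "graph_point f ` {w. hor_inside a b l w} \<subseteq> interior_points S T"
    proof safe
      fix w assume w: "hor_inside a b l w"
      then have lt: "a < w" "w < l" using abl by (auto simp: hor_inside_def)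
      have "graph_point f w \<in> interior (convex hull T)"
        unfolding abl(1)
      proof (rule interior_triangleI[OF abl(2,3)])
        show "rise f a w l / rise f a b l > 0"
          using w lt abl f[of a w l] f[of a b l]
          by (auto simp: hor_inside_def zero_less_divide_iff split: if_splits)
        show "a < w \<and> w < b \<and> rise f a w b / rise f a b l < 0 \<or>
            b < w \<and> w < l \<and> rise f b w l / rise f a b l < 0"
          using w lt abl f[of a w b] f[of b w l] f[of a b l]
          by (auto simp: hor_inside_def divide_less_0_iff split: if_splits)
      qed
      then show "graph_point f w \<in> interior_points S T"
        using lt abl by (auto simp: interior_points_def S_def)
    qed
    show "finite (interior_points S T)"
      by (simp add: interior_points_def \<open>finite S\<close>)
  qed (auto simp: inj_on_def)
  then show False using T(2) assms(2) unfolding k_def by simp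
qed

section \<open>Triangulations\<close>

lemma general_position_subset: "general_position S \<Longrightarrow> A \<subseteq> S \<Longrightarrow> general_position A"
  by (auto simp: general_position_def)

lemma general_positionD:
  assumes "general_position S" "{a, b, c} \<subseteq> S" "a \<noteq> b" "b \<noteq> c" "a \<noteq> c"
  shows "\<not> collinear {a, b, c}"
  using assms by (simp add: general_position_def)

lemma general_position_independent:
  assumes "general_position S" "t \<subseteq> S" "card t = 3"
  shows "\<not> affine_dependent t"
proof -
  obtain a b c where "t = {a, b, c}" "a \<noteq> b" "b \<noteq> c" "a \<noteq> c"
    using assms(3) by (auto simp: card_3_iff)
  then show ?thesis
    using assms collinear_3_eq_affine_dependent[of a b c] by (auto simp: general_position_def)
qed

text \<open>Disjoint interiors, rather than triangles meeting face to face, are what the counting of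
  interior points relies on.\<close>

definition triangulates :: "(real ^ 2) set set \<Rightarrow> (real ^ 2) set \<Rightarrow> bool" where
  "triangulates T A \<longleftrightarrow> finite T \<and> (\<forall>t\<in>T. t \<subseteq> A \<and> card t = 3 \<and> interior (convex hull t) \<inter> A = {}) \<and>
     (\<Union>t\<in>T. convex hull t) = convex hull A \<and>
     disjoint_family_on (\<lambda>t. interior (convex hull t)) T"

lemma
  assumes "triangulates T A"
  shows triangulates_finite: "finite T"
    and triangulates_cover: "(\<Union>t\<in>T. convex hull t) = convex hull A"
    and triangulates_disjoint: "t \<in> T \<Longrightarrow> u \<in> T \<Longrightarrow> t \<noteq> u \<Longrightarrow>
      interior (convex hull t) \<inter> interior (convex hull u) = {}"
  using assms by (simp_all add: triangulates_def disjoint_family_on_def)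

lemma triangulates_covering:
  assumes "triangulates T A" "p \<in> convex hull A"
  obtains t where "t \<in> T" "p \<in> convex hull t"
  using assms(2) unfolding triangulates_cover[OF assms(1), symmetric] by blast

lemma triangulatesD:
  assumes "triangulates T A" "t \<in> T"
  shows "t \<subseteq> A" "card t = 3" "interior (convex hull t) \<inter> A = {}"
    "interior (convex hull t) \<subseteq> interior (convex hull A)"
  using assms by (auto simp: triangulates_def intro!: interior_mono hull_mono)

section \<open>Triangulating points in convex position\<close>

definition convex_position :: "(real ^ 2) set \<Rightarrow> bool" where
  "convex_position A \<longleftrightarrow> (\<forall>a\<in>A. a \<notin> convex hull (A - {a}))"

lemma convex_position_subset:
  assumes "convex_position A" "B \<subseteq> A"
  shows "convex_position B"
  using assms hull_mono[of "B - {_}" "A - {_}" convex] unfolding convex_position_def by blast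

lemma convex_position_extreme:
  assumes "convex_position A" "finite A" "a \<in> A"
  shows "a extreme_point_of (convex hull A)"
  using extreme_point_of_convex_hull_insert[of "A - {a}" a] assms
  by (simp add: convex_position_def insert_absorb)

lemma convex_position_interior:
  assumes "convex_position A" "finite A"
  shows "interior (convex hull A) \<inter> A = {}"
  using convex_position_extreme[OF assms] extreme_point_not_in_interior by blast

text \<open>The quarter turn, so that \<open>perp (b - a)\<close> is normal to the line through
  \<open>a\<close> and \<open>b\<close>. The side of \<open>x\<close> is read off by comparing
  \<open>perp (b - a) \<bullet> x\<close> with \<open>perp (b - a) \<bullet> a\<close>.\<close>

definition perp :: "real ^ 2 \<Rightarrow> real ^ 2" where
  "perp v = vector [- v $ 2, v $ 1]"

lemma perp_eq_0_iff: "perp v = 0 \<longleftrightarrow> v = 0"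
  by (auto simp: perp_def vec_eq_iff forall_2)

lemma inner_perp_same: "perp (b - a) \<bullet> b = perp (b - a) \<bullet> a"
  by (simp add: perp_def inner_vec_def sum_2 algebra_simps)

text \<open>A vector orthogonal to \<open>perp (b - a)\<close> is a multiple of
  \<open>b - a\<close>; the factor is computed from a coordinate in which \<open>a\<close> and
  \<open>b\<close> differ.\<close>

lemma inner_perp_imp_collinear:
  assumes "a \<noteq> b" "perp (b - a) \<bullet> x = perp (b - a) \<bullet> a"
  shows "collinear {a, b, x}"
proof -
  have eq: "(b $ 1 - a $ 1) * (x $ 2 - a $ 2) = (b $ 2 - a $ 2) * (x $ 1 - a $ 1)"
    using assms(2) by (simp add: perp_def inner_vec_def sum_2 algebra_simps)
  have solve: "s = r / p * q" if "p \<noteq> 0" "p * s = q * r" for p q r s :: real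
    using that by (simp add: field_simps)
  have "b $ 1 \<noteq> a $ 1 \<or> b $ 2 \<noteq> a $ 2"
    using assms(1) by (auto simp: vec_eq_iff forall_2)
  then obtain u where u: "x $ 1 - a $ 1 = u * (b $ 1 - a $ 1)" "x $ 2 - a $ 2 = u * (b $ 2 - a $ 2)"
  proof
    assume "b $ 1 \<noteq> a $ 1"
    then have "b $ 1 - a $ 1 \<noteq> 0" by simp
    then show ?thesis
      by (intro that[of "(x $ 1 - a $ 1) / (b $ 1 - a $ 1)"] solve[OF _ eq]) simp_all
  next
    assume "b $ 2 \<noteq> a $ 2"
    then have "b $ 2 - a $ 2 \<noteq> 0" by simp
    then show ?thesis
      by (intro that[of "(x $ 2 - a $ 2) / (b $ 2 - a $ 2)"] solve[OF _ eq[symmetric]]) simp_all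
  qed
  have "x $ 1 = (1 - u) * a $ 1 + u * b $ 1" "x $ 2 = (1 - u) * a $ 2 + u * b $ 2"
    using u by (simp_all add: algebra_simps)
  then have "x = (1 - u) *\<^sub>R a + u *\<^sub>R b"
    by (simp add: vec_eq_iff forall_2)
  then have "collinear {b, x, a}"
    unfolding collinear_3_expand by (intro disjI2 exI[of _ u]) simp
  then show ?thesis by (simp add: insert_commute)
qed

lemma general_position_perp:
  assumes "general_position S" "{a, b, x} \<subseteq> S" "a \<noteq> b" "x \<noteq> a" "x \<noteq> b"
  shows "perp (b - a) \<bullet> x \<noteq> perp (b - a) \<bullet> a"
  using assms inner_perp_imp_collinear[of a b x] general_positionD[of S a b x] by auto

text \<open>One of three collinear points lies between the other two, and an extreme point lies
  strictly between no two points of \<open>C\<close>.\<close>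

lemma extreme_line_inter_hull:
  fixes C :: "'a::euclidean_space set"
  assumes "a extreme_point_of C" "b extreme_point_of C" "a \<noteq> b" "z \<in> C" "collinear {a, b, z}"
  shows "z \<in> closed_segment a b"
proof -
  have "a \<in> C" "b \<in> C" using assms(1,2) by (auto simp: extreme_point_of_def)
  then have "a \<notin> open_segment b z" "b \<notin> open_segment z a"
    using assms by (auto simp: extreme_point_of_def)
  moreover consider "a \<in> closed_segment b z" | "b \<in> closed_segment z a" | "z \<in> closed_segment a b"
    using assms(5) unfolding collinear_between_cases between_mem_segment by blast
  ultimately show ?thesis
    using assms(3) by cases (auto simp: open_segment_def)
qed

text \<open>A point of the hull lies on a segment joining the hulls of the two sides. That segment
  crosses the line at a point of the hull of \<open>A\<close>, which by extremality lies between
  \<open>a\<close> and \<open>b\<close>, hence in both hulls; each half of the segment then stays in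
  one of them.\<close>

lemma convex_hull_cut:
  fixes A :: "(real ^ 2) set"
  assumes A: "finite A" "convex_position A" and ab: "a \<in> A" "b \<in> A" "a \<noteq> b"
  defines "n \<equiv> perp (b - a)"
  shows "convex hull A = convex hull {x \<in> A. n \<bullet> x \<ge> n \<bullet> a} \<union> convex hull {x \<in> A. n \<bullet> x \<le> n \<bullet> a}"
    (is "_ = convex hull ?U \<union> convex hull ?L")
proof
  show "convex hull ?U \<union> convex hull ?L \<subseteq> convex hull A"
    by (intro Un_least hull_mono) auto
  have abUL: "a \<in> ?U" "b \<in> ?U" "a \<in> ?L" "b \<in> ?L"
    using ab by (auto simp: n_def inner_perp_same)
  have seg: "closed_segment a b \<subseteq> convex hull ?U \<inter> convex hull ?L"
    using abUL by (simp add: closed_segment_subset hull_inc)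
  show "convex hull A \<subseteq> convex hull ?U \<union> convex hull ?L"
  proof
    fix p assume "p \<in> convex hull A"
    moreover have "A \<subseteq> convex hull ?U \<union> convex hull ?L"
      using hull_subset[of ?U convex] hull_subset[of ?L convex] by force
    ultimately have "p \<in> convex hull (convex hull ?U \<union> convex hull ?L)"
      using hull_mono by blast
    then obtain u v x y where p: "p = u *\<^sub>R x + v *\<^sub>R y" "u \<ge> 0" "v \<ge> 0" "u + v = 1"
        and x: "x \<in> convex hull ?U" and y: "y \<in> convex hull ?L"
      using abUL by (subst (asm) convex_hull_union_two) auto
    have "convex hull ?U \<subseteq> {x. n \<bullet> x \<ge> n \<bullet> a}"
      by (rule hull_minimal) (auto simp: convex_halfspace_ge)
    moreover have "convex hull ?L \<subseteq> {x. n \<bullet> x \<le> n \<bullet> a}"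
      by (rule hull_minimal) (auto simp: convex_halfspace_le)
    ultimately obtain z where z: "z \<in> closed_segment x y" "n \<bullet> z = n \<bullet> a"
      using connected_ivt_hyperplane[of "closed_segment x y" y x n "n \<bullet> a"] x y by auto
    have "x \<in> convex hull A" "y \<in> convex hull A"
      using x y hull_mono[of ?U A convex] hull_mono[of ?L A convex] by auto
    then have "z \<in> convex hull A"
      using z(1) closed_segment_subset[of x "convex hull A" y] by auto
    then have "z \<in> closed_segment a b"
      using ab z(2) A by (intro extreme_line_inter_hull[of _ "convex hull A"] convex_position_extreme
          inner_perp_imp_collinear) (auto simp: n_def)
    then have "z \<in> convex hull ?U" "z \<in> convex hull ?L" using seg by auto
    then have "closed_segment x z \<subseteq> convex hull ?U" "closed_segment z y \<subseteq> convex hull ?L"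
      using x y by (simp_all add: closed_segment_subset)
    moreover have "p \<in> closed_segment x y"
      using p by (auto simp: in_segment intro!: exI[of _ v])
    ultimately show "p \<in> convex hull ?U \<union> convex hull ?L"
      using Un_closed_segment[OF z(1)] by blast
  qed
qed

lemma card_2_split:
  assumes "card (M \<union> P) = 4" "M \<inter> P = {}" "finite M" "finite P"
  obtains "M = {}" | "P = {}" | x where "M = {x}" | x where "P = {x}" |
    a b c d where "M = {a, b}" "P = {c, d}" "a \<noteq> b" "c \<noteq> d"
proof -
  have "card M + card P = 4"
    using assms by (simp add: card_Un_disjoint)
  then consider "card M = 0" | "card M = 1" | "card P = 0" | "card P = 1" | "card M = 2" "card P = 2"
    by linarith
  then show ?thesis
  proof cases
    case 1 then show ?thesis using that(1) assms(3) by simp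
  next
    case 2 then show ?thesis using that(3) by (metis card_1_singletonE)
  next
    case 3 then show ?thesis using that(2) assms(4) by simp
  next
    case 4 then show ?thesis using that(4) by (metis card_1_singletonE)
  next
    case 5 then show ?thesis using that(5) by (metis card_2_iff)
  qed
qed

text \<open>Take a Radon partition of four of the points. Convex position excludes a part with at
  most one point, so two pairs remain whose segments cross, and the line through one pair separates
  the other.\<close>

lemma diagonal_exists:
  assumes "finite A" "general_position A" "convex_position A" "card A \<ge> 4"
  obtains a b c d where "{a, b, c, d} \<subseteq> A" "a \<noteq> b"
    "perp (b - a) \<bullet> c > perp (b - a) \<bullet> a" "perp (b - a) \<bullet> d < perp (b - a) \<bullet> a"
proof -
  obtain Q where Q: "Q \<subseteq> A" "card Q = 4" "finite Q"
    using assms(4) by (meson obtain_subset_with_card_n)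
  then have "affine_dependent Q"
    by (intro affine_dependent_biggerset) auto
  then obtain M P where MP: "M \<inter> P = {}" "M \<union> P = Q" "convex hull M \<inter> convex hull P \<noteq> {}"
    using Radon_partition[OF Q(3)] by blast
  have single: "x \<notin> convex hull R" if "R \<subseteq> A" "x \<in> A" "x \<notin> R" for x R
    using that assms(3) hull_mono[of R "A - {x}" convex] by (auto simp: convex_position_def)
  have "finite M" "finite P" using MP(2) Q(3) by (metis finite_Un)+
  have "card (M \<union> P) = 4" using MP(2) Q(2) by simp
  then show ?thesis
  proof (rule card_2_split[OF _ MP(1) \<open>finite M\<close> \<open>finite P\<close>])
    assume "M = {}" then show ?thesis using MP(3) by simp
  next
    assume "P = {}" then show ?thesis using MP(3) by simp
  next
    fix x assume "M = {x}"
    then show ?thesis using MP Q(1) single[of P x] by auto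
  next
    fix x assume "P = {x}"
    then show ?thesis using MP Q(1) single[of M x] by auto
  next
    fix a b c d assume 5: "M = {a, b}" "P = {c, d}" "a \<noteq> b" "c \<noteq> d"
    define n where "n = perp (b - a)"
    have sub: "{a, b, c, d} \<subseteq> A" using 5 MP Q by auto
    have ne: "c \<noteq> a" "c \<noteq> b" "d \<noteq> a" "d \<noteq> b" using 5 MP by auto
    obtain z where z: "z \<in> convex hull {a, b}" "z \<in> convex hull {c, d}"
      using MP(3) 5 by auto
    have "convex hull {a, b} \<subseteq> {x. n \<bullet> x = n \<bullet> a}"
      by (rule hull_minimal) (auto simp: n_def inner_perp_same convex_hyperplane)
    \<comment> \<open>The Radon point is on the line through \<open>a\<close> and \<open>b\<close>
      and between \<open>c\<close> and \<open>d\<close>, which rules out that \<open>c\<close> and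
      \<open>d\<close> are strictly on the same side.\<close>
    then have nz: "n \<bullet> z = n \<bullet> a" using z by auto
    have off: "n \<bullet> c \<noteq> n \<bullet> a" "n \<bullet> d \<noteq> n \<bullet> a"
      using general_position_perp[OF assms(2), of a b c] general_position_perp[OF assms(2), of a b d]
        sub ne 5(3) by (simp_all add: n_def)
    have "\<not> (n \<bullet> c > n \<bullet> a \<and> n \<bullet> d > n \<bullet> a)"
    proof
      assume "n \<bullet> c > n \<bullet> a \<and> n \<bullet> d > n \<bullet> a"
      then have "convex hull {c, d} \<subseteq> {x. n \<bullet> x > n \<bullet> a}"
        by (intro hull_minimal) (auto simp: convex_halfspace_gt)
      then show False using z nz by auto
    qed
    moreover have "\<not> (n \<bullet> c < n \<bullet> a \<and> n \<bullet> d < n \<bullet> a)"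
    proof
      assume "n \<bullet> c < n \<bullet> a \<and> n \<bullet> d < n \<bullet> a"
      then have "convex hull {c, d} \<subseteq> {x. n \<bullet> x < n \<bullet> a}"
        by (intro hull_minimal) (auto simp: convex_halfspace_lt)
      then show False using z nz by auto
    qed
    ultimately consider "n \<bullet> c > n \<bullet> a" "n \<bullet> d < n \<bullet> a" | "n \<bullet> d > n \<bullet> a" "n \<bullet> c < n \<bullet> a"
      using off by linarith
    then show ?thesis
    proof cases
      case 1 then show ?thesis using that[of a b c d] sub 5(3) by (simp add: n_def)
    next
      case 2 then show ?thesis using that[of a b d c] sub 5(3) by (simp add: n_def)
    qed
  qed
qed

text \<open>Cutting along a diagonal leaves two smaller polygons sharing exactly \<open>a\<close>
  and \<open>b\<close>. As \<open>card U + card L = card A + 2\<close>, the counts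
  \<open>card U - 2\<close> and \<open>card L - 2\<close> add up to
  \<open>card A - 2\<close>.\<close>

lemma triangulation_convex_position:
  assumes "finite A" "general_position A" "convex_position A" "card A \<ge> 3"
  shows "\<exists>T. triangulates T A \<and> card T + 2 = card A"
  using assms
proof (induction A rule: finite_psubset_induct)
  case (psubset A)
  show ?case
  proof (cases "card A = 3")
    case True
    then have "triangulates {A} A"
      using convex_position_interior[OF psubset.prems(2) psubset.hyps]
      by (simp add: triangulates_def disjoint_family_on_def)
    then show ?thesis using True by (intro exI[of _ "{A}"]) auto
  next
    case False
    then have "card A \<ge> 4" using psubset.prems by linarith
    then obtain a b c d where abcd: "{a, b, c, d} \<subseteq> A" "a \<noteq> b"
        "perp (b - a) \<bullet> c > perp (b - a) \<bullet> a" "perp (b - a) \<bullet> d < perp (b - a) \<bullet> a"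
      using diagonal_exists psubset by metis
    define n where "n = perp (b - a)"
    define U where "U = {x \<in> A. n \<bullet> x \<ge> n \<bullet> a}"
    define L where "L = {x \<in> A. n \<bullet> x \<le> n \<bullet> a}"
    have n0: "n \<noteq> 0" using abcd(2) by (simp add: n_def perp_eq_0_iff)
    have nb: "n \<bullet> b = n \<bullet> a" by (simp add: n_def inner_perp_same)
    have sub: "U \<subseteq> A" "L \<subseteq> A" by (auto simp: U_def L_def)
    have fin: "finite U" "finite L" using psubset.hyps sub by (auto intro: finite_subset)
    have UL: "U \<union> L = A" by (auto simp: U_def L_def)
    have IL: "U \<inter> L = {a, b}"
    proof -
      have "x = a \<or> x = b" if "x \<in> A" "n \<bullet> x = n \<bullet> a" for x
        using that general_position_perp[OF psubset.prems(1), of a b x] abcd by (auto simp: n_def)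
      moreover have "U \<inter> L = {x \<in> A. n \<bullet> x = n \<bullet> a}" by (auto simp: U_def L_def)
      ultimately show ?thesis using abcd nb by auto
    qed
    have cd: "c \<in> U" "c \<notin> L" "d \<in> L" "d \<notin> U"
      using abcd by (auto simp: U_def L_def n_def)
    have card3: "card U \<ge> 3" "card L \<ge> 3"
    proof -
      have "c \<noteq> a" "c \<noteq> b" "d \<noteq> a" "d \<noteq> b" using abcd nb by (auto simp: n_def)
      then have "card {a, b, c} = 3" "card {a, b, d} = 3" using abcd(2) by auto
      moreover have "{a, b, c} \<subseteq> U" "{a, b, d} \<subseteq> L" using IL cd by auto
      ultimately show "card U \<ge> 3" "card L \<ge> 3" using fin card_mono by metis+
    qed
    obtain T1 where T1: "triangulates T1 U" "card T1 + 2 = card U"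
      using psubset.IH[of U] sub cd card3 general_position_subset[OF psubset.prems(1)]
        convex_position_subset[OF psubset.prems(2)] by blast
    obtain T2 where T2: "triangulates T2 L" "card T2 + 2 = card L"
      using psubset.IH[of L] sub cd card3 general_position_subset[OF psubset.prems(1)]
        convex_position_subset[OF psubset.prems(2)] by blast
    have disj: "T1 \<inter> T2 = {}"
    proof (rule ccontr)
      assume "T1 \<inter> T2 \<noteq> {}"
      then obtain t where t: "t \<in> T1" "t \<in> T2" by auto
      then have "t \<subseteq> U \<inter> L" "card t = 3"
        using triangulatesD(1,2)[OF T1(1)] triangulatesD(1)[OF T2(1)] by auto
      then have "t \<subseteq> {a, b}" "card t = 3" using IL by simp_all
      then show False using card_mono[of "{a, b}" t] abcd(2) by auto
    qed
    have fT: "finite T1" "finite T2" using T1 T2 by (auto simp: triangulates_def)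
    have above: "interior (convex hull t) \<subseteq> {x. n \<bullet> x > n \<bullet> a}" if "t \<in> T1" for t
    proof -
      have "convex hull t \<subseteq> {x. n \<bullet> x \<ge> n \<bullet> a}"
        using triangulatesD(1)[OF T1(1) that] by (intro hull_minimal) (auto simp: U_def convex_halfspace_ge)
      from interior_mono[OF this] show ?thesis using n0 by simp
    qed
    have below: "interior (convex hull t) \<subseteq> {x. n \<bullet> x < n \<bullet> a}" if "t \<in> T2" for t
    proof -
      have "convex hull t \<subseteq> {x. n \<bullet> x \<le> n \<bullet> a}"
        using triangulatesD(1)[OF T2(1) that] by (intro hull_minimal) (auto simp: L_def convex_halfspace_le)
      from interior_mono[OF this] show ?thesis using n0 by simp
    qed
    have "triangulates (T1 \<union> T2) A"
      unfolding triangulates_def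
    proof (intro conjI ballI)
      show "(\<Union>t\<in>T1 \<union> T2. convex hull t) = convex hull A"
        using convex_hull_cut[OF psubset.hyps psubset.prems(2), of a b] abcd(1,2)
          triangulates_cover[OF T1(1)] triangulates_cover[OF T2(1)]
        by (simp add: UN_Un U_def L_def n_def)
      show "disjoint_family_on (\<lambda>t. interior (convex hull t)) (T1 \<union> T2)"
        unfolding disjoint_family_on_def
      proof (intro ballI impI)
        fix t u assume tu: "t \<in> T1 \<union> T2" "u \<in> T1 \<union> T2" "t \<noteq> u"
        have cross: "interior (convex hull v) \<inter> interior (convex hull w) = {}" if "v \<in> T1" "w \<in> T2" for v w
          using above[OF that(1)] below[OF that(2)] by fastforce
        consider "t \<in> T1" "u \<in> T1" | "t \<in> T2" "u \<in> T2" | "t \<in> T1" "u \<in> T2" | "t \<in> T2" "u \<in> T1"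
          using tu by blast
        then show "interior (convex hull t) \<inter> interior (convex hull u) = {}"
          using triangulates_disjoint[OF T1(1) _ _ tu(3)] triangulates_disjoint[OF T2(1) _ _ tu(3)] cross
          by cases (blast | metis Int_commute)+
      qed
    next
      fix t assume "t \<in> T1 \<union> T2"
      then show t: "t \<subseteq> A" "card t = 3" using sub triangulatesD T1 T2 by blast+
      show "interior (convex hull t) \<inter> A = {}"
        using convex_position_interior[OF psubset.prems(2) psubset.hyps]
          interior_mono[OF hull_mono[OF t(1), of convex]] by blast
    qed (use fT in auto)
    moreover have "card (T1 \<union> T2) + 2 = card A"
      using card_Un_Int[of U L] fin UL IL card_Un_disjoint[OF fT disj] T1 T2 abcd(2) by auto
    ultimately show ?thesis by blast
  qed
qed

section \<open>Inserting further points into a triangulation\<close>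

lemma not_in_hull_edge:
  assumes "general_position (insert p t)" "p \<notin> t" "card t = 3" "x \<in> t"
  shows "p \<notin> convex hull (t - {x})"
proof
  assume "p \<in> convex hull (t - {x})"
  moreover have "card (t - {x}) = 2" using assms(3,4) by simp
  then obtain y z where yz: "t - {x} = {y, z}" "y \<noteq> z"
    unfolding card_2_iff by blast
  ultimately have "collinear {p, y, z}"
    using assms by (auto simp: collinear_between_cases between_mem_segment segment_convex_hull)
  moreover have "{p, y, z} \<subseteq> insert p t" "p \<noteq> y" "p \<noteq> z" using yz assms by auto
  ultimately show False using general_positionD[OF assms(1), of p y z] yz by auto
qed

text \<open>By general position \<open>p\<close> is on no edge, so none of its barycentric
  coordinates vanishes.\<close>

lemma in_hull_imp_interior:
  assumes "general_position (insert p t)" "p \<notin> t" "card t = 3" "p \<in> convex hull t"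
  shows "p \<in> interior (convex hull t)"
proof -
  obtain a b c where t: "t = {a, b, c}" "a \<noteq> b" "b \<noteq> c" "a \<noteq> c"
    using assms(3) by (auto simp: card_3_iff)
  obtain u v w where uvw: "u \<ge> 0" "v \<ge> 0" "w \<ge> 0" "u + v + w = 1" "p = u *\<^sub>R a + v *\<^sub>R b + w *\<^sub>R c"
    using assms(4) unfolding t(1) convex_hull_3 by auto
  have edges: "p \<notin> convex hull {b, c}" "p \<notin> convex hull {a, c}" "p \<notin> convex hull {a, b}"
    using not_in_hull_edge[OF assms(1-3), of a] not_in_hull_edge[OF assms(1-3), of b]
      not_in_hull_edge[OF assms(1-3), of c] t by (auto simp: insert_Diff_if)
  have "u \<noteq> 0" using uvw edges(1) by (auto simp: convex_hull_2)
  moreover have "v \<noteq> 0" using uvw edges(2) by (auto simp: convex_hull_2)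
  moreover have "w \<noteq> 0" using uvw edges(3) by (auto simp: convex_hull_2)
  moreover have "\<not> collinear {a, b, c}"
    using t by (intro general_positionD[OF assms(1)]) auto
  ultimately have "0 < u" "0 < v" "0 < w" "\<not> collinear {a, b, c}"
    using uvw by auto
  then show ?thesis
    using uvw(4,5) interior_convex_hull_3_minimal[of a b c] unfolding t(1) by auto
qed

text \<open>The triangle \<open>t\<close> containing \<open>p\<close> is replaced by the three
  triangles that join \<open>p\<close> to the edges of \<open>t\<close>; this adds two
  triangles.\<close>

lemma triangulation_insert:
  assumes T: "triangulates T A" and gp: "general_position (insert p A)"
    and p: "p \<notin> A" "p \<in> convex hull A"
  shows "\<exists>T'. triangulates T' (insert p A) \<and> card T' = card T + 2"
proof -
  obtain t where t: "t \<in> T" "p \<in> convex hull t"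
    using triangulates_covering[OF T p(2)] .
  note tA = triangulatesD[OF T t(1)]
  have pt: "p \<notin> t" using p tA by auto
  have gpt: "general_position (insert p t)"
    using gp tA by (auto intro: general_position_subset)
  have ft: "finite t" using tA(2) by (simp add: card_ge_0_finite)
  have hull_A: "convex hull (insert p A) = convex hull A"
    using p(2) by (metis hull_redundant)
  define s where "s x = insert p (t - {x})" for x
  have s: "s x \<subseteq> insert p A" "card (s x) = 3" "convex hull (s x) \<subseteq> convex hull t"
    "p \<notin> interior (convex hull (s x))" if "x \<in> t" for x
  proof -
    show "s x \<subseteq> insert p A" using tA by (auto simp: s_def)
    show "card (s x) = 3" using that tA(2) ft pt by (simp add: s_def)
    show "convex hull (s x) \<subseteq> convex hull t"
      using t(2) hull_subset[of t convex] by (intro hull_minimal) (auto simp: s_def)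
    show "p \<notin> interior (convex hull (s x))"
      unfolding s_def using not_in_hull_edge[OF gpt pt tA(2) that] ft
      by (intro extreme_point_not_in_interior extreme_point_of_convex_hull_insert) auto
  qed
  have inj: "inj_on s t"
    by (rule inj_onI) (use pt in \<open>auto simp: s_def\<close>)
  have p_int: "p \<in> interior (convex hull t)"
    by (rule in_hull_imp_interior[OF gpt pt tA(2) t(2)])
  note disj_T = triangulates_disjoint[OF T]
  define T' where "T' = (T - {t}) \<union> s ` t"
  have "triangulates T' (insert p A)"
    unfolding triangulates_def
  proof (intro conjI ballI)
    show "finite T'" using T ft by (auto simp: T'_def triangulates_def)
  next
    fix u assume u: "u \<in> T'"
    then consider "u \<in> T" | x where "x \<in> t" "u = s x" by (auto simp: T'_def)
    then show "u \<subseteq> insert p A" "card u = 3"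
      using s(1,2) triangulatesD(1,2)[OF T, of u] by (cases; blast)+
    show "interior (convex hull u) \<inter> insert p A = {}"
    proof (cases "u \<in> T - {t}")
      case True
      then show ?thesis using disj_T[of u t] t(1) p_int triangulatesD(3)[OF T, of u] by auto
    next
      case False
      then obtain x where "x \<in> t" "u = s x" using u by (auto simp: T'_def)
      then show ?thesis using s(4)[of x] interior_mono[OF s(3)[of x]] tA(3) by auto
    qed
  next
    have "(\<Union>u\<in>s ` t. convex hull u) = convex hull t"
      using convex_hull_exchange_Union[OF t(2)] by (simp add: s_def)
    then have "(\<Union>u\<in>T'. convex hull u) = (\<Union>u\<in>T. convex hull u)"
      using t(1) unfolding T'_def by (auto simp: UN_Un)
    then show "(\<Union>u\<in>T'. convex hull u) = convex hull (insert p A)"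
      using T hull_A by (simp add: triangulates_def)
  next
    have new_new: "interior (convex hull (s x)) \<inter> interior (convex hull (s y)) = {}"
      if "x \<in> t" "y \<in> t" "x \<noteq> y" for x y
    proof -
      \<comment> \<open>Two new triangles meet only in the segment from \<open>p\<close> to their
        other common vertex, and a segment has empty interior.\<close>
      let ?e = "insert p ((t - {x}) \<inter> (t - {y}))"
      have "convex hull (s x) \<inter> convex hull (s y) \<subseteq> convex hull ?e"
        using in_convex_hull_exchange_unique[OF general_position_independent[OF gpt subset_insertI tA(2)] t(2),
            of "t - {x}" "t - {y}"] unfolding s_def by blast
      then have "interior (convex hull (s x)) \<inter> interior (convex hull (s y)) \<subseteq> interior (convex hull ?e)"
        by (metis interior_Int interior_mono)
      moreover have "(t - {x}) \<inter> (t - {y}) = t - {x, y}" by auto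
      then have "card ?e = 2"
        using that tA(2) ft pt by (simp add: card_Diff_subset)
      then have "interior (convex hull ?e) = {}"
        using ft by (intro empty_interior_convex_hull) auto
      ultimately show ?thesis by auto
    qed
    have new_old: "interior (convex hull (s x)) \<inter> interior (convex hull u) = {}"
      if "x \<in> t" "u \<in> T - {t}" for x u
      using disj_T[of u t] that t(1) interior_mono[OF s(3)[OF that(1)]] by blast
    show "disjoint_family_on (\<lambda>u. interior (convex hull u)) T'"
      unfolding disjoint_family_on_def
    proof (intro ballI impI)
      fix u v assume uv: "u \<in> T'" "v \<in> T'" "u \<noteq> v"
      consider "u \<in> T - {t}" "v \<in> T - {t}" | x where "u \<in> T - {t}" "x \<in> t" "v = s x"
        | x where "v \<in> T - {t}" "x \<in> t" "u = s x" | x y where "x \<in> t" "y \<in> t" "u = s x" "v = s y"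
        using uv unfolding T'_def by blast
      then show "interior (convex hull u) \<inter> interior (convex hull v) = {}"
      proof cases
        case 1 then show ?thesis using disj_T uv(3) by simp
      next
        case (2 x) then show ?thesis using new_old[of x u] by (simp add: Int_commute)
      next
        case (3 x) then show ?thesis using new_old[of x v] by simp
      next
        case (4 x y) then show ?thesis using new_new[of x y] uv(3) by blast
      qed
    qed
  qed
  moreover have "card T' = card T + 2"
  proof -
    have "(T - {t}) \<inter> s ` t = {}"
      using triangulatesD(1)[OF T] p(1) by (auto simp: s_def)
    moreover have "finite T" using T by (simp add: triangulates_def)
    ultimately have "card T' = card (T - {t}) + card (s ` t)"
      using ft by (simp add: T'_def card_Un_disjoint)
    also have "\<dots> = card T + 2"
      using t(1) \<open>finite T\<close> inj tA(2) card_Suc_Diff1[of T t] by (simp add: card_image)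
    finally show ?thesis .
  qed
  ultimately show ?thesis by blast
qed

lemma triangulation_union:
  assumes "finite Q" "triangulates T A" "general_position (A \<union> Q)" "Q \<inter> A = {}" "Q \<subseteq> convex hull A"
  shows "\<exists>T'. triangulates T' (A \<union> Q) \<and> card T' = card T + 2 * card Q"
  using assms
proof (induction Q rule: finite_induct)
  case empty
  then show ?case by auto
next
  case (insert q Q)
  have "general_position (A \<union> Q)"
    using insert.prems(2) by (auto intro: general_position_subset)
  then obtain T' where T': "triangulates T' (A \<union> Q)" "card T' = card T + 2 * card Q"
    using insert by auto
  have "q \<in> convex hull (A \<union> Q)"
    using insert.prems(4) hull_mono[of A "A \<union> Q" convex] by auto
  then obtain T'' where "triangulates T'' (insert q (A \<union> Q))" "card T'' = card T' + 2"
    using triangulation_insert[OF T'(1), of q] insert.prems insert.hyps by auto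
  then show ?case using T' insert.hyps by auto
qed

section \<open>Triangulating an arbitrary finite set\<close>

lemma extreme_points_polygon:
  fixes A :: "(real ^ 2) set"
  assumes "finite A" "general_position A" "card A \<ge> 3"
  defines "E \<equiv> {x. x extreme_point_of (convex hull A)}"
  shows "E \<subseteq> A" "convex hull E = convex hull A" "convex_position E" "card E \<ge> 3"
proof -
  show EA: "E \<subseteq> A" unfolding E_def by (rule extreme_points_of_convex_hull)
  show hull: "convex hull E = convex hull A"
    unfolding E_def using Krein_Milman_polytope[OF assms(1)] by simp
  show "convex_position E"
    unfolding convex_position_def
  proof (intro ballI notI)
    fix e assume e: "e \<in> E" "e \<in> convex hull (E - {e})"
    \<comment> \<open>Removing \<open>e\<close> would not change the hull, yet extreme points of a
      hull belong to the generating set.\<close>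
    then have "convex hull (E - {e}) = convex hull E"
      by (metis hull_redundant insert_Diff)
    then have "e extreme_point_of (convex hull (E - {e}))"
      using e(1) hull by (simp add: E_def)
    then show False using extreme_point_of_convex_hull by blast
  qed
  show "card E \<ge> 3"
  proof (rule ccontr)
    assume "\<not> card E \<ge> 3"
    \<comment> \<open>With at most two extreme points, all of \<open>A\<close> would lie in the
      affine hull of a collinear set.\<close>
    then have "collinear E"
      using EA assms(1) by (intro collinear_small) (auto intro: finite_subset)
    moreover obtain t where t: "t \<subseteq> A" "card t = 3"
      using assms(3) by (meson obtain_subset_with_card_n)
    have "t \<subseteq> affine hull E"
      using t(1) hull hull_subset[of A convex] convex_hull_subset_affine_hull[of E] by auto
    ultimately have "collinear t"
      by (meson collinear_affine_hull_collinear collinear_subset)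
    then show False using t assms(2) by (auto simp: general_position_def)
  qed
qed

text \<open>The \<open>h\<close> extreme points give \<open>h - 2\<close> triangles, and each of the
  \<open>card A - h\<close> other points adds two.\<close>

lemma triangulation_exists:
  fixes A :: "(real ^ 2) set"
  assumes "finite A" "general_position A" "card A \<ge> 3"
  shows "\<exists>T. triangulates T A \<and> card T + card {x. x extreme_point_of (convex hull A)} + 2 = 2 * card A"
proof -
  define E where "E = {x. x extreme_point_of (convex hull A)}"
  note E = extreme_points_polygon[OF assms, folded E_def]
  have fE: "finite E" using E(1) assms(1) by (rule finite_subset)
  obtain T where T: "triangulates T E" "card T + 2 = card E"
    using triangulation_convex_position[OF fE _ E(3,4)] general_position_subset[OF assms(2) E(1)] by auto
  have "\<exists>T'. triangulates T' (E \<union> (A - E)) \<and> card T' = card T + 2 * card (A - E)"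
    using assms E hull_subset[of A convex] by (intro triangulation_union[OF _ T(1)]) (auto simp: Un_absorb1)
  moreover have "E \<union> (A - E) = A" using E(1) by auto
  moreover have "card (A - E) + card E = card A"
    using E(1) assms(1) by (metis Diff_disjoint card_Un_disjoint fE finite_Diff inf_commute add.commute \<open>E \<union> (A - E) = A\<close>)
  ultimately show ?thesis using T(2) unfolding E_def[symmetric] by fastforce
qed

section \<open>Almost empty triangles\<close>

text \<open>The interiors are disjoint and contain no point of \<open>A\<close>, so the points
  counted in different triangles are distinct and all lie outside \<open>A\<close>.\<close>

lemma card_ge_triangulation:
  assumes T: "triangulates T A" and "finite W"
    and many: "\<And>t. t \<in> T \<Longrightarrow> m \<le> card (W \<inter> interior (convex hull t))"
  shows "m * card T \<le> card (W \<inter> interior (convex hull A) - A)"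
proof -
  have "m * card T \<le> (\<Sum>t\<in>T. card (W \<inter> interior (convex hull t)))"
    using sum_bounded_below[of T m] many by (simp add: mult.commute)
  also have "\<dots> = card (\<Union>t\<in>T. W \<inter> interior (convex hull t))"
  proof (rule card_UN_disjoint[symmetric])
    show "\<forall>t\<in>T. \<forall>u\<in>T. t \<noteq> u \<longrightarrow>
        (W \<inter> interior (convex hull t)) \<inter> (W \<inter> interior (convex hull u)) = {}"
      using triangulates_disjoint[OF T] by blast
  qed (use \<open>finite W\<close> triangulates_finite[OF T] in auto)
  also have "\<dots> \<le> card (W \<inter> interior (convex hull A) - A)"
    using triangulatesD(3,4)[OF T] \<open>finite W\<close> by (intro card_mono) blast+
  finally show ?thesis .
qed

text \<open>A line through two points that include all of \<open>A - E\<close> has at least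
  \<open>m\<close> points of \<open>E\<close> strictly on one side; the 2 in the bound allows for
  points of \<open>E\<close> on the line. The hull of those \<open>m\<close> points misses the line,
  and convex position keeps out the rest of \<open>E\<close>.\<close>

lemma polygon_avoiding_few_points:
  fixes A :: "(real ^ 2) set"
  assumes A: "finite A" "general_position A" and E: "E \<subseteq> A" "convex_position E"
    and "card A \<ge> 2" "card (A - E) \<le> 2" "card E \<ge> 2 * m + 2"
  obtains F where "F \<subseteq> E" "card F \<ge> m" "convex hull F \<inter> A = F"
proof -
  obtain u v where uv: "{u, v} \<subseteq> A" "u \<noteq> v" "A - E \<subseteq> {u, v}"
  proof -
    \<comment> \<open>If fewer than two points are non-extreme, points of \<open>E\<close> are added
      so that a line is determined.\<close>
    obtain X where "A - E \<subseteq> X" "X \<subseteq> A" "card X = 2"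
      using exists_subset_between[of "A - E" 2 A] assms by auto
    then show ?thesis using that by (auto simp: card_2_iff)
  qed
  define n where "n = perp (v - u)"
  define U where "U = {x \<in> E. n \<bullet> x > n \<bullet> u}"
  define L where "L = {x \<in> E. n \<bullet> x < n \<bullet> u}"
  have nv: "n \<bullet> v = n \<bullet> u" by (simp add: n_def inner_perp_same)
  have fE: "finite E" using A E finite_subset by blast
  have "E \<subseteq> U \<union> L \<union> {u, v}"
    using general_position_perp[OF A(2), of u v] uv E by (force simp: U_def L_def n_def)
  then have "card E \<le> card (U \<union> L \<union> {u, v})"
    using fE by (intro card_mono) (auto simp: U_def L_def)
  also have "\<dots> \<le> card U + card L + 2"
    using card_Un_le[of "U \<union> L" "{u, v}"] card_Un_le[of U L] uv(2) by simp
  finally have "m \<le> card U \<or> m \<le> card L" using assms by linarith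
  then obtain F where F: "F = U \<or> F = L" "m \<le> card F" by auto
  have FE: "F \<subseteq> E" using F by (auto simp: U_def L_def)
  have "convex hull U \<subseteq> {x. n \<bullet> x > n \<bullet> u}" "convex hull L \<subseteq> {x. n \<bullet> x < n \<bullet> u}"
    by (intro hull_minimal; auto simp: U_def L_def convex_halfspace_gt convex_halfspace_lt)+
  then have "u \<notin> convex hull F" "v \<notin> convex hull F"
    using F nv by auto
  moreover have "x \<notin> convex hull F" if "x \<in> E" "x \<notin> F" for x
    using that E(2) hull_mono[of F "E - {x}" convex] FE by (auto simp: convex_position_def)
  ultimately have "convex hull F \<inter> A \<subseteq> F"
    using uv by blast
  then have "convex hull F \<inter> A = F"
    using FE E(1) hull_subset[of F convex] by blast
  then show ?thesis using that FE F by auto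
qed

text \<open>Colours are values of a function, and at most \<open>c\<close> of them occur, so that
  the statement passes to subsets that miss colours. For \<open>c = 1\<close> the truncated bound
  \<open>c - 2\<close> is 0.\<close>

lemma almost_empty_triangle:
  assumes "c \<ge> 1"
  shows "\<exists>N. \<forall>S (col :: real ^ 2 \<Rightarrow> 'k). finite S \<and> general_position S \<and> card (col ` S) \<le> c \<and> N \<le> card S \<longrightarrow>
    (\<exists>t k. t \<subseteq> S \<and> card t = 3 \<and> col ` t \<subseteq> {k} \<and> card (S \<inter> interior (convex hull t)) \<le> c - 2)"
  using assms
proof (induction c rule: nat_induct_at_least)
  case base
  show ?case
  proof (intro exI[of _ 3] allI impI; elim conjE)
    fix S :: "(real ^ 2) set" and col :: "real ^ 2 \<Rightarrow> 'k"
    assume S: "finite S" "general_position S" "card (col ` S) \<le> 1" "3 \<le> card S"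
    obtain T where T: "triangulates T S"
      using triangulation_exists[OF S(1,2,4)] by blast
    have "S \<noteq> {}" using S(4) by auto
    then obtain p where "p \<in> convex hull S" by (meson ex_in_conv hull_inc)
    then obtain t where "t \<in> T" using triangulates_covering[OF T] by blast
    note t = triangulatesD[OF T this]
    have "card (col ` S) \<le> Suc 0" using S(3) by simp
    then have "\<forall>x\<in>col ` S. \<forall>y\<in>col ` S. x = y"
      by (simp only: card_le_Suc0_iff_eq[OF finite_imageI[OF S(1)]])
    then obtain k where "col ` S \<subseteq> {k}"
      using \<open>S \<noteq> {}\<close> by blast
    then show "\<exists>t k. t \<subseteq> S \<and> card t = 3 \<and> col ` t \<subseteq> {k} \<and> card (S \<inter> interior (convex hull t)) \<le> 1 - 2"
      using t(1-3) image_mono[OF t(1), of col]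
      by (intro exI[of _ t] exI[of _ k]) (auto simp only: Int_commute card.empty)
  qed
next
  case (Suc c)
  from Suc.IH obtain N where N: "\<forall>S (col :: real ^ 2 \<Rightarrow> 'k). finite S \<and> general_position S \<and> card (col ` S) \<le> c \<and> N \<le> card S \<longrightarrow>
      (\<exists>t k. t \<subseteq> S \<and> card t = 3 \<and> col ` t \<subseteq> {k} \<and> card (S \<inter> interior (convex hull t)) \<le> c - 2)"
    by (rule exE)
  show ?case
  \<comment> \<open>The largest class has \<open>n \<ge> 2 * N + 10\<close> points, at least
    \<open>n - 2 \<ge> 2 * (N + 3) + 2\<close> of them extreme. The polygon cut off has at least
    \<open>N + 3\<close> vertices and so more than \<open>N\<close> triangles, each with at least
    one point inside.\<close>
  proof (intro exI[of _ "Suc c * (2 * N + 10)"] allI impI; elim conjE)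
    fix S :: "(real ^ 2) set" and col :: "real ^ 2 \<Rightarrow> 'k"
    assume S: "finite S" "general_position S" "card (col ` S) \<le> Suc c" "Suc c * (2 * N + 10) \<le> card S"
    show "\<exists>t k. t \<subseteq> S \<and> card t = 3 \<and> col ` t \<subseteq> {k} \<and> card (S \<inter> interior (convex hull t)) \<le> Suc c - 2"
    proof (rule ccontr)
      assume none: "\<nexists>t k. t \<subseteq> S \<and> card t = 3 \<and> col ` t \<subseteq> {k} \<and> card (S \<inter> interior (convex hull t)) \<le> Suc c - 2"
      have many: "c \<le> card (S \<inter> interior (convex hull t))"
        if "t \<subseteq> S" "card t = 3" "col ` t \<subseteq> {k}" for t k
      proof (rule ccontr)
        assume "\<not> ?thesis"
        then have "card (S \<inter> interior (convex hull t)) \<le> Suc c - 2" using Suc.hyps by simp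
        then show False
          using none that by blast
      qed
      have "S \<noteq> {}" using S(4) by auto
      then obtain k where k: "k \<in> col ` S" "card S \<le> card (col -` {k} \<inter> S) * card (col ` S)"
        using pigeonhole_card[of col S "col ` S"] S(1) by blast
      define A where "A = col -` {k} \<inter> S"
      define n where "n = card A"
      have Sn: "card S \<le> n * Suc c"
        using k(2) S(3) mult_le_mono2[OF S(3), of n] unfolding A_def n_def by linarith
      have "(2 * N + 10) * Suc c \<le> n * Suc c"
        using Sn S(4) by (simp only: mult.commute[of "Suc c"])
      then have n: "2 * N + 10 \<le> n" by (simp only: mult_le_cancel2)
      have AS: "A \<subseteq> S" "finite A" "col ` A \<subseteq> {k}" using S(1) by (auto simp: A_def)
      have gpA: "general_position A" using S(2) AS(1) by (rule general_position_subset)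
      define E where "E = {x. x extreme_point_of (convex hull A)}"
      have card3: "card A \<ge> 3" using n by (simp add: n_def)
      note E = extreme_points_polygon[OF AS(2) gpA card3, folded E_def]
      have mono: "c \<le> card (S \<inter> interior (convex hull t))" if "t \<subseteq> A" "card t = 3" for t
        using many[of t k] that AS by blast
      obtain T where T: "triangulates T A" "card T + card E + 2 = 2 * n"
        using triangulation_exists[OF AS(2) gpA card3] by (auto simp: E_def n_def)
      have "c * card T \<le> card (S \<inter> interior (convex hull A) - A)"
        using triangulatesD[OF T(1)] mono by (intro card_ge_triangulation[OF T(1) S(1)]) auto
      also have "\<dots> \<le> card (S - A)"
        using S(1) by (intro card_mono) auto
      also have "\<dots> \<le> c * n"
        using Sn AS(1,2) by (simp add: card_Diff_subset n_def mult.commute)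
      \<comment> \<open>The other classes have at most \<open>c * n\<close> points in all, while
        each triangle uses up \<open>c\<close> of them.\<close>
      finally have "card T \<le> n" using Suc.hyps by simp
      then have En: "n \<le> card E + 2" using T(2) by linarith
      have "card (A - E) \<le> 2"
        using En E(1) AS(2) by (simp add: card_Diff_subset finite_subset n_def)
      moreover have "card E \<ge> 2 * (N + 3) + 2" using En n by auto
      ultimately obtain F where F: "F \<subseteq> E" "card F \<ge> N + 3" "convex hull F \<inter> A = F"
        using polygon_avoiding_few_points[OF AS(2) gpA E(1,3)] card3 by (metis Suc_leD numeral_2_eq_2 numeral_3_eq_3)
      have FA: "F \<subseteq> A" using F(1) E(1) by auto
      have fF: "finite F" using FA AS(2) by (rule finite_subset)
      have cF: "convex_position F" using E(3) F(1) by (rule convex_position_subset)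
      obtain T' where T': "triangulates T' F" "card T' + 2 = card F"
        using triangulation_convex_position[OF fF general_position_subset[OF gpA FA] cF] F(2) by auto
      define S' where "S' = S \<inter> interior (convex hull F)"
      have "c * card T' \<le> card (S \<inter> interior (convex hull F) - F)"
      proof (rule card_ge_triangulation[OF T'(1) S(1)])
        fix t assume "t \<in> T'"
        note triangulatesD(1,2)[OF T'(1) this]
        then show "c \<le> card (S \<inter> interior (convex hull t))" using FA by (intro mono) auto
      qed
      also have "\<dots> \<le> card S'"
        using S(1) by (intro card_mono) (auto simp: S'_def)
      finally have "card T' \<le> card S'"
        using mult_le_mono1[OF Suc.hyps, of "card T'"] by linarith
      then have "N \<le> card S'" using T'(2) F(2) by linarith
      \<comment> \<open>The polygon contains no points of \<open>A\<close> but its vertices, and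
        these are not interior; hence colour \<open>k\<close> is absent from
        \<open>S'\<close>.\<close>
      moreover have "S' \<inter> A = {}"
        using F(3) convex_position_interior[OF cF fF] interior_subset[of "convex hull F"]
        by (auto simp: S'_def)
      then have "col ` S' \<subseteq> col ` S - {k}"
        by (auto simp: S'_def A_def)
      then have "card (col ` S') \<le> card (col ` S - {k})"
        using S(1) by (intro card_mono) auto
      then have "card (col ` S') \<le> c"
        using S(1,3) k(1) by simp
      moreover have "finite S'" "general_position S'"
        using S(1,2) by (auto simp: S'_def intro: general_position_subset)
      ultimately obtain t l where t: "t \<subseteq> S'" "card t = 3" "col ` t \<subseteq> {l}"
          "card (S' \<inter> interior (convex hull t)) \<le> c - 2"
        using N[rule_format, of S' col] by blast
      have "convex hull t \<subseteq> convex hull F"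
        using t(1) interior_subset[of "convex hull F"] by (intro hull_minimal) (auto simp: S'_def)
      \<comment> \<open>Passing to \<open>S'\<close> loses no interior point of \<open>t\<close>, so
        the induction hypothesis contradicts \<open>many\<close>.\<close>
      then have "S \<inter> interior (convex hull t) = S' \<inter> interior (convex hull t)"
        using interior_mono by (auto simp: S'_def)
      moreover have "c \<le> card (S \<inter> interior (convex hull t))"
        using t by (intro many[of t l]) (auto simp: S'_def)
      ultimately show False using t(4) Suc.hyps by simp
    qed
  qed
qed

section \<open>From colour functions to \<open>M3\<close> and \<open>lambda3\<close>\<close>

lemma ex_forces_triangle:
  assumes "c \<ge> 1"
  shows "\<exists>n. forces_triangle c (c - 2) n"
proof -
  from almost_empty_triangle[OF assms] obtain N
    where N: "\<forall>S (col :: real ^ 2 \<Rightarrow> (real ^ 2) set). finite S \<and> general_position S \<and> card (col ` S) \<le> c \<and> N \<le> card S \<longrightarrow>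
      (\<exists>t k. t \<subseteq> S \<and> card t = 3 \<and> col ` t \<subseteq> {k} \<and> card (S \<inter> interior (convex hull t)) \<le> c - 2)"
    by (rule exE)
  have "forces_triangle c (c - 2) N"
    unfolding forces_triangle_def
  proof (intro allI impI; elim conjE)
    fix S P assume S: "finite S" "general_position S" "colored c S P" "N \<le> card S"
    then have P: "partition_on S P" "card P = c" by (auto simp: colored_def)
    then have "finite P" using assms by (simp add: card_ge_0_finite)
    \<comment> \<open>The colour of a point is its own class, so colours are themselves sets of
      points.\<close>
    define col where "col x = (THE C. C \<in> P \<and> x \<in> C)" for x
    have col: "col x \<in> P \<and> x \<in> col x" if "x \<in> S" for x
    proof -
      have "\<exists>!C. C \<in> P \<and> x \<in> C"
        using P(1) that by (auto simp: partition_on_def disjoint_def)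
      then show ?thesis unfolding col_def by (rule theI')
    qed
    have "card (col ` S) \<le> c"
      using card_mono[OF \<open>finite P\<close>, of "col ` S"] col P(2) by auto
    then obtain t k where t: "t \<subseteq> S" "card t = 3" "col ` t \<subseteq> {k}"
        "card (S \<inter> interior (convex hull t)) \<le> c - 2"
      using N[rule_format, of S col] S by blast
    have "t \<noteq> {}" using t(2) by auto
    moreover have "x \<in> S \<and> col x = k" if "x \<in> t" for x using that t(1,3) by blast
    ultimately have "k \<in> P" "t \<subseteq> k" using col by blast+
    then show "\<exists>T. monochromatic_triangle P T \<and> card (interior_points S T) \<le> c - 2"
      using t by (auto simp: monochromatic_triangle_def interior_points_def)
  qed
  then show ?thesis by blast
qed

theorem theorem2:
  fixes c :: nat
  assumes "c \<ge> 2"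
  shows "(\<exists>s. M3 c s < \<infinity>) \<and> (c - 1) div 2 \<le> lambda3 c \<and> lambda3 c \<le> c - 2"
proof -
  have finite_iff: "M3 c s < \<infinity> \<longleftrightarrow> (\<exists>n. forces_triangle c s n)" for s
    by (simp add: M3_def)
  have fin: "M3 c (c - 2) < \<infinity>"
    unfolding finite_iff using ex_forces_triangle[of c] assms by simp
  then have "M3 c (lambda3 c) < \<infinity>"
    unfolding lambda3_def by (rule LeastI)
  \<comment> \<open>A smaller \<open>lambda3 c\<close> would be a value of \<open>s\<close> excluded
    by the Horton sets.\<close>
  then have "(c - 1) div 2 \<le> lambda3 c"
    using not_forces_triangle[OF assms] finite_iff not_le by blast
  moreover have "lambda3 c \<le> c - 2"
    unfolding lambda3_def using fin by (rule Least_le)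
  ultimately show ?thesis using fin by blast
qed

end
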